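(* Let $K\ge1$ be an integer. If $3\mid K$, then $\pi_K(3)=2$; otherwise $\pi_K(3)=8$.
   Context: The $K$-Fibonacci sequence is $F_{K,0}=0$, $F_{K,1}=1$, $F_{K,n}=K F_{K,n-1}+F_{K,n-2}$; for an integer $m>1$, $\pi_K(m)$ is the length of its shortest period modulo $m$. *)

theory Defs
  imports "HOL-Number_Theory.Cong"
begin

fun kfib :: "int \<Rightarrow> nat \<Rightarrow> int" where
  "kfib K 0 = 0"
| "kfib K (Suc 0) = 1"
| "kfib K (Suc (Suc n)) = K * kfib K (Suc n) + kfib K n"

text \<open>The recurrence can be run backwards modulo \<open>m\<close>, so the sequence is purely periodic
  modulo any \<open>m > 1\<close>: a period is required to hold from index 0 on.\<close>

definition is_kfib_period :: "int \<Rightarrow> int \<Rightarrow> nat \<Rightarrow> bool" where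
  "is_kfib_period K m p \<longleftrightarrow> p > 0 \<and> (\<forall>n. [kfib K (n + p) = kfib K n] (mod m))"

definition kfib_pisano :: "int \<Rightarrow> int \<Rightarrow> nat" where
  "kfib_pisano K m = (LEAST p. is_kfib_period K m p)"

end

theory Submission
  imports Defs
begin

text \<open>Modulo 3 the sequence depends only on the residue of \<open>K\<close>, and a
  second-order recurrence repeats from index 0 as soon as the pair of consecutive values (0, 1)
  returns (\<open>is_kfib_period_iff\<close>). So three short computations suffice: residue 0 gives
  0, 1, 0, 1; residue 1 gives 0, 1, 1, 2, 0, 2, 2, 1, 0, 1; residue 2 gives 0, 1, 2, 2, 0, 2, 1, 1,
  0, 1.\<close>

lemma kfib_cong_parameter:
  assumes "[K = L] (mod m)"
  shows "[kfib K n = kfib L n] (mod m)"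
  using assms
proof (induction K n rule: kfib.induct)
  case (3 K n)
  then show ?case by (simp add: cong_add cong_mult)
qed simp_all

lemma is_kfib_period_cong_parameter:
  assumes "[K = L] (mod m)"
  shows "is_kfib_period K m p \<longleftrightarrow> is_kfib_period L m p"
  using kfib_cong_parameter[OF assms] unfolding is_kfib_period_def cong_def by simp

lemma kfib_pisano_mod: "kfib_pisano (K mod m) m = kfib_pisano K m"
  using is_kfib_period_cong_parameter[of "K mod m" K m] by (simp add: kfib_pisano_def)

text \<open>Two consecutive values determine all later ones, so the congruences at
  \<open>n = 0\<close> and \<open>n = 1\<close> propagate by induction along the recurrence. This
  replaces the quantifier over \<open>n\<close> by a check that evaluation can settle for each
  concrete \<open>p\<close>.\<close>

lemma is_kfib_period_iff:
  "is_kfib_period K m p \<longleftrightarrow>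
    p > 0 \<and> [kfib K p = 0] (mod m) \<and> [kfib K (Suc p) = 1] (mod m)"
proof
  assume "is_kfib_period K m p"
  then have "p > 0" "[kfib K (0 + p) = kfib K 0] (mod m)" "[kfib K (1 + p) = kfib K 1] (mod m)"
    unfolding is_kfib_period_def by blast+
  then show "p > 0 \<and> [kfib K p = 0] (mod m) \<and> [kfib K (Suc p) = 1] (mod m)" by simp
next
  assume *: "p > 0 \<and> [kfib K p = 0] (mod m) \<and> [kfib K (Suc p) = 1] (mod m)"
  have "[kfib K (n + p) = kfib K n] (mod m)" for n
    using *
  proof (induction K n rule: kfib.induct)
    case (3 K n)
    then show ?case by (simp add: cong_add cong_mult)
  qed simp_all
  with * show "is_kfib_period K m p" by (simp add: is_kfib_period_def)
qed

lemma kfib_pisano_0_3: "kfib_pisano 0 3 = 2"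
  unfolding kfib_pisano_def
proof (rule Least_equality)
  show "is_kfib_period 0 3 2" by (simp add: is_kfib_period_iff numeral_eq_Suc)
next
  fix p assume "is_kfib_period 0 3 p"
  \<comment> \<open>Length 1 fails because the term at index 1 is 1, not 0, modulo 3.\<close>
  then show "2 \<le> p" by (cases "p = 1") (auto simp: is_kfib_period_iff cong_def)
qed

lemma kfib_pisano_3_eq_8:
  assumes "K = 1 \<or> K = 2"
  shows "kfib_pisano K 3 = 8"
  unfolding kfib_pisano_def
proof (rule Least_equality)
  show "is_kfib_period K 3 8"
    using assms by (auto simp: is_kfib_period_iff cong_def eval_nat_numeral)
next
  fix p assume p: "is_kfib_period K 3 p"
  show "8 \<le> p"
  proof (rule ccontr)
    assume "\<not> 8 \<le> p"
    then have "p \<in> {0, 1, 2, 3, 4, 5, 6, 7}" by auto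
    \<comment> \<open>Among the lengths 1 to 7 only 4 gives a term divisible by 3, and there the
      next term is 2, that is -1: the sequence has only changed sign.\<close>
    with p assms show False by (auto simp: is_kfib_period_iff cong_def eval_nat_numeral)
  qed
qed

theorem theorem2p10:
  fixes K :: int
  assumes "K \<ge> 1"
  shows "(3 dvd K \<longrightarrow> kfib_pisano K 3 = 2) \<and> (\<not> 3 dvd K \<longrightarrow> kfib_pisano K 3 = 8)"
proof (intro conjI impI)
  assume "3 dvd K"
  then show "kfib_pisano K 3 = 2"
    using kfib_pisano_mod[of K 3] by (simp add: kfib_pisano_0_3)
next
  assume "\<not> 3 dvd K"
  then have "K mod 3 = 1 \<or> K mod 3 = 2" by presburger
  then show "kfib_pisano K 3 = 8"
    using kfib_pisano_mod[of K 3] kfib_pisano_3_eq_8 by metis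
qed

end
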